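(* For all integers $d \ge 9$ and $k$ with $3\sqrt{d} \le k \le d$ there exists a constant $C > 0$ (depending on $d$ and $k$) such that for all integers $n \ge k$, $$\Delta_{k,d}(n) \le C\, n^{-\frac{k-1}{d} - \frac{k^2}{8d^2}}.$$
   Context: For integers $2 \le k \le d+1$ and $n \ge k$, $\Delta_{k,d}(n)$ denotes the minimum $\Delta > 0$ such that among any $n$ (distinct) points in $[0,1]^d$ there are $k$ points which form a simplex with $(k-1)$-dimensional volume at most $\Delta$ (the simplex is the convex hull of the $k$ points; if it is degenerate its volume is $0$). *)

theory Defs
  imports "HOL-Analysis.Analysis"
begin

definition orthonormal :: "'a::euclidean_space set \<Rightarrow> bool" where
  "orthonormal B \<longleftrightarrow> pairwise orthogonal B \<and> (\<forall>b\<in>B. norm b = 1)"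

text \<open>Lebesgue measure of dimension \<open>card B\<close> on the subspace spanned by an orthonormal set \<open>B\<close>,
  viewed as a Borel measure on the ambient space. It generalises the library's construction of
  \<^const>\<open>lborel\<close>, which is the case \<open>B = Basis\<close>.\<close>

definition subspace_lborel :: "'a::euclidean_space set \<Rightarrow> 'a measure" where
  "subspace_lborel B = distr (\<Pi>\<^sub>M b\<in>B. lborel) borel (\<lambda>f. \<Sum>b\<in>B. f b *\<^sub>R b)"

lemma subspace_lborel_Basis: "subspace_lborel Basis = lborel"
  unfolding subspace_lborel_def by (rule lborel_eq [symmetric])

definition flat_frame :: "nat \<Rightarrow> 'a::euclidean_space set \<Rightarrow> 'a \<times> 'a set \<Rightarrow> bool" where
  "flat_frame m S = (\<lambda>(p, B). orthonormal B \<and> card B = m \<and> S \<subseteq> (\<lambda>v. p + v) ` span B)"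

text \<open>The \<open>m\<close>-dimensional volume of a set \<open>S\<close> contained in an \<open>m\<close>-dimensional flat \<open>p + span B\<close>:
  the \<open>m\<close>-dimensional Lebesgue measure of \<open>S\<close> in that flat. By invariance of Lebesgue measure under
  isometries the value does not depend on the chosen frame \<open>(p, B)\<close>; if \<open>S\<close> lies in a flat of
  smaller dimension, the value is \<open>0\<close>. The definition is meaningful only if some frame
  exists (see \<open>flat_frame_exists\<close> below).\<close>

definition flat_volume :: "nat \<Rightarrow> 'a::euclidean_space set \<Rightarrow> real" where
  "flat_volume m S =
     (let (p, B) = (SOME F. flat_frame m S F)
      in measure (subspace_lborel B) ((\<lambda>x. x - p) ` S))"

lemma flat_frame_exists:
  fixes S :: "'a::euclidean_space set"
  assumes "aff_dim S \<le> int m" "m \<le> DIM('a)"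
  shows "\<exists>F. flat_frame m S F"
proof -
  obtain p where p: "S \<noteq> {} \<Longrightarrow> p \<in> S" by blast
  define T where "T = (\<lambda>x. x - p) ` S"
  have "dim T \<le> m"
  proof (cases "S = {}")
    case False
    then have "aff_dim S = int (dim T)"
      unfolding T_def by (intro aff_dim_eq_dim_subtract hull_inc p)
    with assms show ?thesis by simp
  qed (simp add: T_def)
  obtain A where A: "A \<subseteq> T" "independent A" "T \<subseteq> span A" "card A = dim T"
    by (rule basis_exists)
  obtain A' where A': "A \<subseteq> A'" "independent A'" "UNIV \<subseteq> span A'"
    using maximal_independent_subset_extend [of A UNIV] A(2) by auto
  have "dim (span A') = card A'" using dim_eq_card_independent [OF A'(2)] by simp
  moreover have "span A' = UNIV" using A'(3) by auto
  ultimately have "card A' = DIM('a)" by simp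
  then obtain C where C: "A \<subseteq> C" "C \<subseteq> A'" "card C = m"
    using exists_subset_between [of A m A'] A(4) \<open>dim T \<le> m\<close> assms(2) A'(1)
      independent_imp_finite [OF A'(2)] by auto
  define W where "W = span C"
  have W: "subspace W" "T \<subseteq> W" "dim W = m"
    using A(3) C span_mono [OF C(1)] dim_eq_card_independent [OF independent_mono [OF A'(2) C(2)]]
    by (auto simp: W_def)
  obtain B where B: "pairwise orthogonal B" "\<And>x. x \<in> B \<Longrightarrow> norm x = 1" "card B = dim W" "span B = W"
    by (rule orthonormal_basis_subspace [OF W(1)]) blast
  have "S \<subseteq> (\<lambda>v. p + v) ` span B"
  proof
    fix x assume "x \<in> S"
    then have "x - p \<in> span B" using W(2) B(4) by (auto simp: T_def)
    then show "x \<in> (\<lambda>v. p + v) ` span B" by (intro image_eqI [of _ _ "x - p"]) auto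
  qed
  then have "flat_frame m S (p, B)"
    using B W(3) by (simp add: flat_frame_def orthonormal_def)
  then show ?thesis ..
qed

text \<open>\<open>heilbronn_simplex TYPE('d) k n\<close> is $\Delta_{k,d}(n)$ for \<open>d = CARD('d)\<close>. For
  \<open>2 \<le> k \<le> d + 1\<close> and \<open>n \<ge> k\<close> the infimum is positive and attained, hence is the minimum.\<close>

definition heilbronn_simplex :: "'d::finite itself \<Rightarrow> nat \<Rightarrow> nat \<Rightarrow> real" where
  "heilbronn_simplex _ k n =
     Inf {\<Delta>. \<Delta> > 0 \<and>
       (\<forall>P :: (real ^ 'd) set. P \<subseteq> cbox 0 1 \<and> finite P \<and> card P = n \<longrightarrow>
          (\<exists>K \<subseteq> P. card K = k \<and> flat_volume (k - 1) (convex hull K) \<le> \<Delta>))}"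

end

theory Submission
  imports Defs
begin

text \<open>
  Given \<open>n\<close> points in the unit cube of \<open>\<real>\<^sup>d\<close>, the plain pigeonhole argument puts \<open>k\<close> of them
  in a cell of side about \<open>n powr (- 1 / d)\<close>, and so yields a simplex of volume
  \<open>O(n powr (- (k - 1) / d))\<close>. The improvement comes from choosing the vertices in two clusters,
  because the second cluster has to be tight only modulo the directions of the first.

  Put \<open>m = (k - 1) div 2\<close>. The pigeonhole principle gives a cluster \<open>S\<close> of \<open>m + 1\<close> points at mutual
  distance \<open>O(\<delta>)\<close>, where \<open>\<delta> = n powr (- 1 / d)\<close>; let \<open>V\<close> be an \<open>m\<close>-dimensional space that
  contains its directions. Project the remaining points to the orthogonal complement of \<open>V\<close>. It has
  only dimension \<open>d - m\<close>, so among the projections there are \<open>k - m - 1\<close> at mutual distance \<open>O(\<epsilon>)\<close>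
  with the smaller value \<open>\<epsilon> = n powr (- 1 / (d - m))\<close>; they come from a set \<open>T\<close>. Build the simplex
  on \<open>S \<union> T\<close> edge by edge: the edges inside \<open>S\<close> contribute \<open>\<delta>\<close> each, one edge from \<open>S\<close> to \<open>T\<close>
  contributes \<open>O(1)\<close>, and each of the \<open>k - m - 2\<close> edges inside \<open>T\<close> contributes its distance \<open>O(\<epsilon>)\<close>
  from \<open>V\<close>. The volume is thus \<open>O(\<delta> ^ m * \<epsilon> ^ (k - m - 2))\<close>. The connecting edge loses a factor
  \<open>n powr (1 / d)\<close> against the plain argument, but passing from \<open>d\<close> to \<open>d - m\<close> gains roughly
  \<open>n powr (k\<^sup>2 / (4 * d\<^sup>2))\<close>. As soon as \<open>k\<^sup>2 \<ge> 9 * d\<close> the balance is at least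
  \<open>n powr (k\<^sup>2 / (8 * d\<^sup>2))\<close> (lemma \<open>exponent_gain\<close>).

  The clusters come from \<open>clustered_subset_exists\<close>, and the volume estimate is
  \<open>flat_volume_two_clusters\<close>. Only the order of magnitude of the volume matters, so it is controlled
  by the number of small balls needed to cover the simplex. Such a count involves no coordinates, so it
  bounds the measure in whatever orthonormal frame \<^const>\<open>flat_volume\<close> happens to select.
\<close>

section \<open>Volume bounds by covering numbers\<close>

text \<open>Up to a constant that depends on \<open>N\<close>, the number \<open>a\<close> is an upper bound for the upper
  \<open>N\<close>-dimensional Minkowski content of \<open>A\<close>.\<close>
definition content_le :: "nat \<Rightarrow> real \<Rightarrow> 'a::metric_space set \<Rightarrow> bool" where
  "content_le N a A \<longleftrightarrow>
     (\<exists>r0>0. \<forall>r. 0 < r \<and> r \<le> r0 \<longrightarrow>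
        (\<exists>F. finite F \<and> real (card F) * r ^ N \<le> a \<and> A \<subseteq> (\<Union>x\<in>F. cball x r)))"

text \<open>For convex \<open>A\<close> that contains \<open>0\<close> in its relative interior, this says that \<open>u\<close> is a direction
  of the span of \<open>A\<close>.\<close>
definition absorbs :: "'a::real_vector set \<Rightarrow> 'a \<Rightarrow> bool" where
  "absorbs A u \<longleftrightarrow> (\<exists>c>0. \<forall>\<theta>. \<bar>\<theta>\<bar> \<le> c \<longrightarrow> \<theta> *\<^sub>R u \<in> A)"

lemma absorbs_mono: "absorbs A u \<Longrightarrow> A \<subseteq> B \<Longrightarrow> absorbs B u"
  unfolding absorbs_def by blast

text \<open>The Minkowski sum of \<open>A\<close> and the parallelepiped with the edges \<open>[- v t, v t]\<close>.\<close>
definition extrude :: "'a::real_vector set \<Rightarrow> 'b set \<Rightarrow> ('b \<Rightarrow> 'a) \<Rightarrow> 'a set" where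
  "extrude A T v = {x + (\<Sum>t\<in>T. c t *\<^sub>R v t) |x c. x \<in> A \<and> (\<forall>t\<in>T. \<bar>c t\<bar> \<le> 1)}"

lemma extrudeI:
  assumes "x \<in> A" "\<And>t. t \<in> T \<Longrightarrow> \<bar>c t\<bar> \<le> 1" "y = x + (\<Sum>t\<in>T. c t *\<^sub>R v t)"
  shows "y \<in> extrude A T v"
  using assms unfolding extrude_def by blast

lemma subset_extrude: "A \<subseteq> extrude A T v"
  by (auto intro: extrudeI [where c = "\<lambda>_. 0"])

lemma add_member_extrude:
  assumes "finite T" "t \<in> T" "x \<in> A"
  shows "x + v t \<in> extrude A T v"
proof (rule extrudeI [where c = "\<lambda>s. if s = t then 1 else 0"])
  show "x + v t = x + (\<Sum>s\<in>T. (if s = t then 1 else 0) *\<^sub>R v s)"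
    using assms by (simp add: if_distrib [of "\<lambda>c. c *\<^sub>R _"] sum.delta cong: if_cong)
qed (use assms in auto)

lemma convex_extrude:
  assumes "convex A"
  shows "convex (extrude A T v)"
proof (rule convexI)
  fix x y and a b :: real
  assume x: "x \<in> extrude A T v" and y: "y \<in> extrude A T v" and ab: "0 \<le> a" "0 \<le> b" "a + b = 1"
  obtain p c where p: "p \<in> A" "\<forall>t\<in>T. \<bar>c t\<bar> \<le> 1" "x = p + (\<Sum>t\<in>T. c t *\<^sub>R v t)"
    using x unfolding extrude_def by blast
  obtain q d where q: "q \<in> A" "\<forall>t\<in>T. \<bar>d t\<bar> \<le> 1" "y = q + (\<Sum>t\<in>T. d t *\<^sub>R v t)"
    using y unfolding extrude_def by blast
  show "a *\<^sub>R x + b *\<^sub>R y \<in> extrude A T v"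
  proof (rule extrudeI)
    show "a *\<^sub>R p + b *\<^sub>R q \<in> A" using assms p(1) q(1) ab by (simp add: convexD)
    show "\<bar>a * c t + b * d t\<bar> \<le> 1" if "t \<in> T" for t
    proof -
      have "\<bar>a * c t + b * d t\<bar> \<le> a * \<bar>c t\<bar> + b * \<bar>d t\<bar>"
        using ab by (metis abs_mult abs_of_nonneg abs_triangle_ineq)
      also have "\<dots> \<le> a * 1 + b * 1"
        using p(2) q(2) that ab by (intro add_mono mult_left_mono) auto
      finally show ?thesis using ab by simp
    qed
    show "a *\<^sub>R x + b *\<^sub>R y = a *\<^sub>R p + b *\<^sub>R q + (\<Sum>t\<in>T. (a * c t + b * d t) *\<^sub>R v t)"
      unfolding p(3) q(3)
      by (simp add: scaleR_right_distrib scaleR_sum_right scaleR_left_distrib sum.distrib)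
  qed
qed

lemma extrude_insert:
  assumes "finite T" "t \<notin> T"
  shows "extrude A (insert t T) v \<subseteq> extrude (extrude A T v) {t} v"
proof
  fix y assume "y \<in> extrude A (insert t T) v"
  then obtain x c where x: "x \<in> A" "\<forall>s\<in>insert t T. \<bar>c s\<bar> \<le> 1"
    "y = x + (\<Sum>s\<in>insert t T. c s *\<^sub>R v s)"
    unfolding extrude_def by blast
  have "x + (\<Sum>s\<in>T. c s *\<^sub>R v s) \<in> extrude A T v"
    using x by (intro extrudeI [of x A T c]) auto
  then show "y \<in> extrude (extrude A T v) {t} v"
    by (rule extrudeI [where c = c]) (use x assms in \<open>auto simp: algebra_simps\<close>)
qed

lemma content_le_nonneg: "content_le N a A \<Longrightarrow> 0 \<le> a"
  unfolding content_le_def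
  by (metis dual_order.refl less_eq_real_def mult_nonneg_nonneg of_nat_0_le_iff order_trans
      zero_le_power)

lemma content_le_mono:
  assumes "content_le N a A" "a \<le> b" "B \<subseteq> A"
  shows "content_le N b B"
proof -
  obtain r0 where "r0 > 0" and r0: "\<And>r. 0 < r \<Longrightarrow> r \<le> r0 \<Longrightarrow>
      \<exists>F. finite F \<and> real (card F) * r ^ N \<le> a \<and> A \<subseteq> (\<Union>x\<in>F. cball x r)"
    using assms(1) unfolding content_le_def by blast
  show ?thesis
    unfolding content_le_def
  proof (intro exI [of _ r0] conjI allI impI)
    fix r assume "0 < r \<and> r \<le> r0"
    then obtain F where "finite F" "real (card F) * r ^ N \<le> a" "A \<subseteq> (\<Union>x\<in>F. cball x r)"
      using r0 by blast
    then show "\<exists>F. finite F \<and> real (card F) * r ^ N \<le> b \<and> B \<subseteq> (\<Union>x\<in>F. cball x r)"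
      using assms(2,3) by (intro exI [of _ F]) auto
  qed fact
qed

text \<open>This replaces the formula ``base times height'' for a sheared prism: a segment in direction \<open>v t\<close>
  increases the content only by the distance \<open>\<rho>\<close> of \<open>v t\<close> from the directions of \<open>A\<close>, however long
  \<open>v t\<close> itself may be. Cut the segment into about \<open>\<rho> / r\<close> pieces. Along one piece the component
  transversal to \<open>A\<close> moves by at most \<open>r / 2\<close>. The component along \<open>u\<close> may move much further than
  that, but when \<open>r\<close> is small this displacement lies in \<open>A\<close>, and by convexity it takes points
  of \<open>A\<close> into \<open>2 A\<close>. So the piece is covered by a translate of a covering of \<open>2 A\<close>.\<close>
lemma content_le_extrude_one:
  fixes A :: "'a::real_normed_vector set"
  assumes A: "content_le N a A" "convex A" and u: "absorbs A u"
    and \<rho>: "norm (v t - u) \<le> \<rho>" "0 < \<rho>"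
  shows "content_le (Suc N) (4 ^ (N + 2) * \<rho> * a) (extrude A {t} v)"
proof -
  obtain r0 where r0: "r0 > 0" and cover: "\<And>r. 0 < r \<Longrightarrow> r \<le> r0 \<Longrightarrow>
      \<exists>F. finite F \<and> real (card F) * r ^ N \<le> a \<and> A \<subseteq> (\<Union>x\<in>F. cball x r)"
    using A(1) unfolding content_le_def by blast
  obtain c where c: "c > 0" "\<And>\<theta>. \<bar>\<theta>\<bar> \<le> c \<Longrightarrow> \<theta> *\<^sub>R u \<in> A"
    using u unfolding absorbs_def by blast
  \<comment> \<open>The bounds on \<open>r\<close> give, in this order: a cover of \<open>A\<close> at scale \<open>r / 4\<close>, at most \<open>4 * \<rho> / r\<close>
    steps in each direction, and steps short enough to be absorbed.\<close>
  define r1 where "r1 = min r0 (min (2 * \<rho>) (2 * \<rho> * c))"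
  have r1: "r1 > 0" using r0 \<rho> c by (simp add: r1_def)
  show ?thesis
    unfolding content_le_def
  proof (intro exI [of _ r1] conjI allI impI r1)
    fix r assume r: "0 < r \<and> r \<le> r1"
    then have "0 < r / 4" "r / 4 \<le> r0" by (auto simp: r1_def)
    then obtain F where F: "finite F" "real (card F) * (r / 4) ^ N \<le> a" "A \<subseteq> (\<Union>x\<in>F. cball x (r / 4))"
      using cover by blast
    define J where "J = \<lceil>2 * \<rho> / r\<rceil>"
    have J: "2 * \<rho> / r \<le> real_of_int J" "real_of_int J \<le> 2 * \<rho> / r + 1"
      by (auto simp: J_def)
    have "1 \<le> 2 * \<rho> / r" "1 / c \<le> 2 * \<rho> / r" using r c by (auto simp: r1_def field_simps)
    then have J1: "1 \<le> real_of_int J" "1 / c \<le> real_of_int J" "real_of_int J \<le> 4 * \<rho> / r"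
      using J by auto
    then have Jpos: "0 < real_of_int J" by linarith
    have invJ: "1 / J \<le> c" "\<rho> / J \<le> r / 2"
      using J1(2) J(1) Jpos c(1) r by (auto simp: field_simps)
    \<comment> \<open>Doubling a cover of \<open>A\<close> at scale \<open>r / 4\<close> gives a cover of \<open>2 A\<close> at scale \<open>r / 2\<close>; the other
      \<open>r / 2\<close> is left for the transversal displacement.\<close>
    define G where "G = (\<lambda>(y, j). 2 *\<^sub>R y + (real_of_int j / J) *\<^sub>R v t) ` (F \<times> {-J..J})"
    show "\<exists>F. finite F \<and> real (card F) * r ^ Suc N \<le> 4 ^ (N + 2) * \<rho> * a \<and>
           extrude A {t} v \<subseteq> (\<Union>x\<in>F. cball x r)"
    proof (intro exI [of _ G] conjI)
      show "finite G" using F(1) by (simp add: G_def)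
      have "card G \<le> card F * nat (2 * J + 1)"
        unfolding G_def using card_image_le [of "F \<times> {-J..J}"] F(1)
        by (simp add: card_cartesian_product)
      then have "real (card G) \<le> real (card F * nat (2 * J + 1))" by (rule of_nat_mono)
      also have "\<dots> = real (card F) * (2 * real_of_int J + 1)" using Jpos by simp
      also have "\<dots> \<le> real (card F) * (16 * \<rho> / r)"
        using J1 by (intro mult_left_mono) auto
      finally have "real (card G) * r ^ Suc N \<le> real (card F) * (16 * \<rho> / r) * r ^ Suc N"
        using r by (intro mult_right_mono) auto
      also have "\<dots> = 4 ^ (N + 2) * \<rho> * (real (card F) * (r / 4) ^ N)"
        using r by (simp add: field_simps)
      also have "\<dots> \<le> 4 ^ (N + 2) * \<rho> * a"
        using F(2) \<rho>(2) by (intro mult_left_mono) auto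
      finally show "real (card G) * r ^ Suc N \<le> 4 ^ (N + 2) * \<rho> * a" .
      show "extrude A {t} v \<subseteq> (\<Union>x\<in>G. cball x r)"
      proof
        fix z assume "z \<in> extrude A {t} v"
        then obtain x \<tau> where x: "x \<in> A" "\<bar>\<tau>\<bar> \<le> 1" "z = x + \<tau> *\<^sub>R v t"
          unfolding extrude_def by auto
        define j where "j = \<lfloor>\<tau> * J\<rfloor>"
        define \<theta> where "\<theta> = \<tau> - j / J"
        have "\<bar>\<tau> * J\<bar> \<le> J" using x(2) Jpos by (simp add: abs_mult)
        then have j: "j \<in> {-J..J}" unfolding j_def by (auto simp: le_floor_iff floor_le_iff)
        have "\<bar>\<theta> * J\<bar> \<le> 1"
          unfolding \<theta>_def j_def using Jpos by (simp add: left_diff_distrib abs_if) linarith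
        then have \<theta>: "\<bar>\<theta>\<bar> \<le> 1 / J" using Jpos by (simp add: abs_mult field_simps)
        then have "\<theta> *\<^sub>R u \<in> A" using invJ(1) c(2) by simp
        then have "(1/2) *\<^sub>R x + (1/2) *\<^sub>R (\<theta> *\<^sub>R u) \<in> A"
          using A(2) x(1) by (intro convexD) auto
        then obtain y where y: "y \<in> F" "dist y ((1/2) *\<^sub>R x + (1/2) *\<^sub>R (\<theta> *\<^sub>R u)) \<le> r / 4"
          using F(3) by auto
        have near: "norm (2 *\<^sub>R ((1/2) *\<^sub>R x + (1/2) *\<^sub>R (\<theta> *\<^sub>R u) - y)) \<le> r / 2"
          using y(2) by (simp add: dist_norm norm_minus_commute)
        have "norm (\<theta> *\<^sub>R (v t - u)) \<le> 1 / J * \<rho>"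
          unfolding norm_scaleR using \<theta> \<rho>(1) Jpos by (intro mult_mono) auto
        also have "\<dots> \<le> r / 2" using invJ(2) by simp
        finally have "norm (2 *\<^sub>R ((1/2) *\<^sub>R x + (1/2) *\<^sub>R (\<theta> *\<^sub>R u) - y) + \<theta> *\<^sub>R (v t - u)) \<le> r / 2 + r / 2"
          by (rule norm_triangle_mono [OF near])
        also have "2 *\<^sub>R ((1/2) *\<^sub>R x + (1/2) *\<^sub>R (\<theta> *\<^sub>R u) - y) + \<theta> *\<^sub>R (v t - u)
            = z - (2 *\<^sub>R y + (real_of_int j / J) *\<^sub>R v t)"
          unfolding x(3) \<theta>_def by (simp add: algebra_simps)
        finally have "norm (z - (2 *\<^sub>R y + (real_of_int j / J) *\<^sub>R v t)) \<le> r" by simp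
        then have "z \<in> cball (2 *\<^sub>R y + (real_of_int j / J) *\<^sub>R v t) r"
          by (simp add: dist_norm norm_minus_commute)
        then show "z \<in> (\<Union>x\<in>G. cball x r)"
          unfolding G_def using y(1) j by force
      qed
    qed
  qed
qed

text \<open>Directions absorbed by \<open>A\<close> remain absorbed while the segments are added one at a time, so they
  may be discarded from every \<open>v t\<close>. The bound \<open>D\<close> on the final dimension makes \<open>4 ^ (D + 1) * \<rho>\<close> a
  common bound for the factors of the single steps.\<close>
lemma content_le_extrude:
  fixes A :: "'a::real_normed_vector set"
  assumes "finite T" and A: "content_le N a A" "convex A"
    and "\<And>t. t \<in> T \<Longrightarrow> \<exists>u. absorbs A u \<and> norm (v t - u) \<le> \<rho>" and \<rho>: "0 < \<rho>"
    and D: "N + card T \<le> D"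
  shows "content_le (N + card T) ((4 ^ (D + 1) * \<rho>) ^ card T * a) (extrude A T v)"
  using assms(1,4) D
proof (induction T rule: finite_induct)
  case empty
  then show ?case using A(1) by (simp add: extrude_def)
next
  case (insert t T)
  have IH: "content_le (N + card T) ((4 ^ (D + 1) * \<rho>) ^ card T * a) (extrude A T v)"
    using insert by simp
  obtain u where "absorbs A u" "norm (v t - u) \<le> \<rho>" using insert.prems by blast
  then have "content_le (Suc (N + card T))
      (4 ^ (N + card T + 2) * \<rho> * ((4 ^ (D + 1) * \<rho>) ^ card T * a)) (extrude (extrude A T v) {t} v)"
    using A(2) IH \<rho> subset_extrude [of A T v]
    by (intro content_le_extrude_one convex_extrude) (auto intro: absorbs_mono)
  moreover have "4 ^ (N + card T + 2) * \<rho> * ((4 ^ (D + 1) * \<rho>) ^ card T * a)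
      \<le> 4 ^ (D + 1) * \<rho> * ((4 ^ (D + 1) * \<rho>) ^ card T * a)"
    using insert.prems insert.hyps \<rho> content_le_nonneg [OF IH]
    by (intro mult_right_mono power_increasing) auto
  ultimately have "content_le (Suc (N + card T))
      (4 ^ (D + 1) * \<rho> * ((4 ^ (D + 1) * \<rho>) ^ card T * a)) (extrude A (insert t T) v)"
    using extrude_insert [OF insert.hyps(1,2), of A v] by (rule content_le_mono)
  then show ?case using insert.hyps by (simp add: mult.assoc)
qed

text \<open>A ball of radius \<open>r\<close> lies in a cube of side \<open>2 * r\<close> aligned with any given orthonormal frame,
  so the bound is the same for all frames. The centre of the ball may lie off the span of \<open>B\<close>: the
  cube is replaced by the cylinder over it, whose measure is that of its trace on the span.\<close>
lemma measure_subspace_lborel_le_content: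
  fixes A :: "'a::euclidean_space set"
  assumes B: "orthonormal B" "finite B" "card B = N"
    and A: "content_le N a A" and sub: "\<And>x. x \<in> A' \<Longrightarrow> x - p \<in> A"
  shows "measure (subspace_lborel B) A' \<le> 2 ^ N * a"
proof -
  interpret product_sigma_finite "\<lambda>_::'a. lborel :: real measure" ..
  obtain r F where r: "0 < r" and F: "finite F" "real (card F) * r ^ N \<le> a" "A \<subseteq> (\<Union>x\<in>F. cball x r)"
    using A unfolding content_le_def by blast
  define Q where "Q y = {x. \<forall>b\<in>B. \<bar>(x - (p + y)) \<bullet> b\<bar> \<le> r}" for y
  have "Q y = (\<Inter>b\<in>B. {x. \<bar>(x - (p + y)) \<bullet> b\<bar> \<le> r})" for y
    by (auto simp: Q_def)
  moreover have "closed {x. \<bar>(x - (p + y)) \<bullet> b\<bar> \<le> r}" for y b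
    by (intro closed_Collect_le continuous_intros)
  ultimately have Q_borel: "Q y \<in> sets borel" for y
    by (intro borel_closed) auto
  have meas: "(\<lambda>f. \<Sum>b\<in>B. f b *\<^sub>R b) \<in> measurable (\<Pi>\<^sub>M b\<in>B. lborel) borel"
    by measurable
  have inner_sum_B: "(\<Sum>c\<in>B. f c *\<^sub>R c) \<bullet> b = f b" if "b \<in> B" for f and b :: 'a
  proof -
    have "(\<Sum>c\<in>B. f c *\<^sub>R c) \<bullet> b = (\<Sum>c\<in>B. if c = b then f c else 0)"
      unfolding inner_sum_left
    proof (rule sum.cong)
      fix c assume "c \<in> B"
      then show "f c *\<^sub>R c \<bullet> b = (if c = b then f c else 0)"
        using B(1) that by (auto simp: orthonormal_def pairwise_def orthogonal_def norm_eq_1)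
    qed simp
    also have "\<dots> = f b" using B(2) that by simp
    finally show ?thesis .
  qed
  have Q_measure: "emeasure (subspace_lborel B) (Q y) = ennreal ((2 * r) ^ N)" for y
  proof -
    have "(\<lambda>f. \<Sum>b\<in>B. f b *\<^sub>R b) -` Q y \<inter> space (\<Pi>\<^sub>M b\<in>B. lborel)
        = (\<Pi>\<^sub>E b\<in>B. {(p + y) \<bullet> b - r .. (p + y) \<bullet> b + r})"
    proof (rule set_eqI)
      fix f :: "'a \<Rightarrow> real"
      show "f \<in> (\<lambda>f. \<Sum>b\<in>B. f b *\<^sub>R b) -` Q y \<inter> space (\<Pi>\<^sub>M b\<in>B. lborel)
        \<longleftrightarrow> f \<in> (\<Pi>\<^sub>E b\<in>B. {(p + y) \<bullet> b - r .. (p + y) \<bullet> b + r})"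
        by (auto simp: Q_def space_PiM PiE_iff inner_diff_left inner_sum_B abs_le_iff algebra_simps)
    qed
    then have "emeasure (subspace_lborel B) (Q y)
        = emeasure (\<Pi>\<^sub>M b\<in>B. lborel) (\<Pi>\<^sub>E b\<in>B. {(p + y) \<bullet> b - r .. (p + y) \<bullet> b + r})"
      unfolding subspace_lborel_def using meas Q_borel by (simp add: emeasure_distr)
    also have "\<dots> = (\<Prod>b\<in>B. ennreal (2 * r))"
      using r B(2) by (subst emeasure_PiM) (auto simp: algebra_simps)
    also have "\<dots> = ennreal ((2 * r) ^ N)"
      using r B(3) by (simp add: ennreal_power)
    finally show ?thesis .
  qed
  have "A' \<subseteq> (\<Union>y\<in>F. Q y)"
  proof
    fix x assume "x \<in> A'"
    then obtain y where y: "y \<in> F" "dist y (x - p) \<le> r" using sub F(3) by fastforce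
    have "\<bar>(x - (p + y)) \<bullet> b\<bar> \<le> r" if "b \<in> B" for b
    proof -
      have "\<bar>(x - (p + y)) \<bullet> b\<bar> \<le> norm (x - (p + y)) * norm b" by (rule Cauchy_Schwarz_ineq2)
      also have "\<dots> \<le> r"
        using y(2) B(1) that by (simp add: orthonormal_def dist_norm norm_minus_commute algebra_simps)
      finally show ?thesis .
    qed
    then show "x \<in> (\<Union>y\<in>F. Q y)" using y(1) by (auto simp: Q_def)
  qed
  then have "emeasure (subspace_lborel B) A' \<le> emeasure (subspace_lborel B) (\<Union>y\<in>F. Q y)"
    using F(1) Q_borel by (intro emeasure_mono) (auto simp: subspace_lborel_def)
  also have "\<dots> \<le> (\<Sum>y\<in>F. emeasure (subspace_lborel B) (Q y))"
    using F(1) Q_borel by (intro emeasure_subadditive_finite) (auto simp: subspace_lborel_def)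
  also have "\<dots> = ennreal (real (card F) * (2 * r) ^ N)"
    using r by (simp add: Q_measure ennreal_mult ennreal_of_nat_eq_real_of_nat)
  finally have "measure (subspace_lborel B) A' \<le> real (card F) * (2 * r) ^ N"
    unfolding measure_def using r by (simp add: enn2real_leI)
  also have "\<dots> = 2 ^ N * (real (card F) * r ^ N)" by (simp add: power_mult_distrib)
  also have "\<dots> \<le> 2 ^ N * a" using F(2) by simp
  finally show ?thesis .
qed

lemma absorbs_extrude_orthonormal:
  fixes E :: "'a::euclidean_space set"
  assumes E: "orthonormal E" "finite E" and "0 < \<delta>" "u \<in> span E"
  shows "absorbs (extrude {0} E (\<lambda>e. \<delta> *\<^sub>R e)) u"
    and "norm u \<le> \<delta> \<Longrightarrow> u \<in> extrude {0} E (\<lambda>e. \<delta> *\<^sub>R e)"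
proof -
  have *: "u \<in> extrude {0} E (\<lambda>e. \<delta> *\<^sub>R e)" if "norm u \<le> \<delta>" "u \<in> span E" for u
  proof (rule extrudeI [where c = "\<lambda>e. (u \<bullet> e) / \<delta>"])
    show "\<bar>(u \<bullet> e) / \<delta>\<bar> \<le> 1" if "e \<in> E" for e
    proof -
      have "\<bar>u \<bullet> e\<bar> \<le> norm u * norm e" by (rule Cauchy_Schwarz_ineq2)
      also have "\<dots> \<le> \<delta>" using E \<open>norm u \<le> \<delta>\<close> that by (simp add: orthonormal_def)
      finally show ?thesis using \<open>0 < \<delta>\<close> by simp
    qed
    have "(\<Sum>e\<in>E. (u \<bullet> e) *\<^sub>R e) = u"
      using E that(2) by (intro orthonormal_basis_expand) (auto simp: orthonormal_def)
    then show "u = 0 + (\<Sum>e\<in>E. (u \<bullet> e / \<delta>) *\<^sub>R \<delta> *\<^sub>R e)"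
      using \<open>0 < \<delta>\<close> by simp
  qed auto
  show "absorbs (extrude {0} E (\<lambda>e. \<delta> *\<^sub>R e)) u"
    unfolding absorbs_def
  proof (intro exI [of _ "\<delta> / (1 + norm u)"] conjI allI impI)
    show "0 < \<delta> / (1 + norm u)" using \<open>0 < \<delta>\<close> by (simp add: add_pos_nonneg)
    fix \<theta> :: real assume "\<bar>\<theta>\<bar> \<le> \<delta> / (1 + norm u)"
    then have "\<bar>\<theta>\<bar> * (1 + norm u) \<le> \<delta>" by (simp add: add_pos_nonneg pos_le_divide_eq)
    then have "norm (\<theta> *\<^sub>R u) \<le> \<delta>" by (simp add: algebra_simps)
    then show "\<theta> *\<^sub>R u \<in> extrude {0} E (\<lambda>e. \<delta> *\<^sub>R e)"
      using assms(4) by (intro *) (auto intro: span_scale)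
  qed
  show "norm u \<le> \<delta> \<Longrightarrow> u \<in> extrude {0} E (\<lambda>e. \<delta> *\<^sub>R e)" using * assms(4) by blast
qed

text \<open>The simplex is enclosed in a translate of a solid that is built in three stages: a box
  with sides of order \<open>\<delta>\<close> in the span of \<open>E\<close>, which contains the differences in \<open>S\<close>; then one segment
  from \<open>s0\<close> to \<open>t0\<close>; then the differences in \<open>T\<close>. The box absorbs every direction of the span of \<open>E\<close>,
  so the last stage costs only the transversal parts \<open>\<epsilon>\<close>, while the components of \<open>T\<close> along the span
  can be of order 1.\<close>
lemma flat_volume_two_clusters:
  fixes S T E :: "'a::euclidean_space set"
  assumes fin: "finite S" "finite T" and S: "s0 \<in> S" "card S \<le> Suc m" and T: "t0 \<in> T" "card T = Suc q"
    and E: "orthonormal E" "finite E" "card E = m"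
    and S_diam: "\<And>s. s \<in> S \<Longrightarrow> s - s0 \<in> span E \<and> norm (s - s0) \<le> \<delta>"
    and gap: "norm (t0 - s0) \<le> R"
    and T_diam: "\<And>t. t \<in> T \<Longrightarrow> \<exists>u\<in>span E. norm (t - t0 - u) \<le> \<epsilon>"
    and pos: "0 < \<delta>" "0 < R" "0 < \<epsilon>"
    and N: "N = m + 1 + q" "N \<le> DIM('a)"
  shows "flat_volume N (convex hull (S \<union> T)) \<le> 2 ^ N * 4 ^ ((N + 1) * N) * \<delta> ^ m * R * \<epsilon> ^ q"
proof -
  define A where "A = extrude {0} E (\<lambda>e. \<delta> *\<^sub>R e)"
  define A1 where "A1 = extrude A {t0} (\<lambda>t. t - s0)"
  define A2 where "A2 = extrude A1 (T - {t0}) (\<lambda>t. t - t0)"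
  have convex: "convex A" "convex A1" "convex A2"
    by (simp_all add: A_def A1_def A2_def convex_extrude)
  have sub: "A \<subseteq> A1" "A1 \<subseteq> A2" by (simp_all add: A1_def A2_def subset_extrude)
  have zero: "content_le 0 1 {0::'a}"
    unfolding content_le_def by (intro exI [of _ 1]) (auto intro!: exI [of _ "{0::'a}"])
  have zero_abs: "absorbs X 0" if "0 \<in> X" for X :: "'a set"
    using that unfolding absorbs_def by (intro exI [of _ 1]) auto
  have "0 \<in> A" using subset_extrude [of "{0}" E "\<lambda>e. \<delta> *\<^sub>R e"] by (auto simp: A_def)
  let ?c = "4 ^ (N + 1) :: real"
  have "content_le (0 + card E) ((?c * \<delta>) ^ card E * 1) A"
    unfolding A_def using zero E pos N(1)
    by (intro content_le_extrude) (auto intro!: exI [of _ 0] zero_abs simp: orthonormal_def)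
  then have "content_le (m + card {t0}) ((?c * R) ^ card {t0} * ((?c * \<delta>) ^ m)) A1"
    unfolding A1_def using E convex gap pos N(1) \<open>0 \<in> A\<close>
    by (intro content_le_extrude) (auto intro!: exI [of _ 0] zero_abs)
  then have content: "content_le ((m + 1) + card (T - {t0}))
      ((?c * \<epsilon>) ^ card (T - {t0}) * (?c * R * (?c * \<delta>) ^ m)) A2"
    unfolding A2_def
  proof (intro content_le_extrude)
    show "\<exists>u. absorbs A1 u \<and> norm (t - t0 - u) \<le> \<epsilon>" if "t \<in> T - {t0}" for t
      using T_diam [of t] that absorbs_extrude_orthonormal(1) [OF E(1,2) pos(1)] sub(1)
      by (auto simp: A_def intro: absorbs_mono)
  qed (use fin T pos N convex in auto)
  have card_q: "card (T - {t0}) = q" using T fin by simp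
  have "(?c * \<epsilon>) ^ q * (?c * R * (?c * \<delta>) ^ m) = ?c ^ N * \<delta> ^ m * R * \<epsilon> ^ q"
    unfolding N(1) by (simp add: power_mult_distrib power_add)
  also have "?c ^ N = 4 ^ ((N + 1) * N)" by (rule power_mult [symmetric])
  finally have content_A2: "content_le N (4 ^ ((N + 1) * N) * \<delta> ^ m * R * \<epsilon> ^ q) A2"
    using content unfolding card_q N(1) [symmetric] by (simp only:)
  have S_mem: "s - s0 \<in> A2" if "s \<in> S" for s
    using absorbs_extrude_orthonormal(2) [OF E(1,2) pos(1)] S_diam [OF that] sub
    by (auto simp: A_def)
  have t0_mem: "t0 - s0 \<in> A1"
    using add_member_extrude [of "{t0}" t0 0 A "\<lambda>t. t - s0"] \<open>0 \<in> A\<close> by (simp add: A1_def)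
  have T_mem: "t - s0 \<in> A2" if "t \<in> T" for t
  proof (cases "t = t0")
    case False
    then show ?thesis
      using add_member_extrude [of "T - {t0}" t "t0 - s0" A1 "\<lambda>t. t - t0"] that fin t0_mem
      by (simp add: A2_def)
  qed (use t0_mem sub in auto)
  have hull: "convex hull (S \<union> T) \<subseteq> (\<lambda>x. s0 + x) ` A2"
  proof (rule hull_minimal)
    show "S \<union> T \<subseteq> (\<lambda>x. s0 + x) ` A2"
    proof
      fix x assume "x \<in> S \<union> T"
      then have "x - s0 \<in> A2" using S_mem T_mem by blast
      then show "x \<in> (\<lambda>x. s0 + x) ` A2" by (intro image_eqI [of _ _ "x - s0"]) auto
    qed
  qed (use convex in \<open>simp add: convex_translation\<close>)
  have "card (S \<union> T) \<le> Suc N"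
    using card_Un_le [of S T] S(2) T(2) N(1) by simp
  then have "aff_dim (convex hull (S \<union> T)) \<le> int N"
    using aff_dim_le_card [of "S \<union> T"] fin by (simp add: aff_dim_convex_hull)
  then obtain F where "flat_frame N (convex hull (S \<union> T)) F"
    using flat_frame_exists N(2) by blast
  then have frame: "flat_frame N (convex hull (S \<union> T)) (SOME F. flat_frame N (convex hull (S \<union> T)) F)"
    by (rule someI)
  obtain p B where pB: "(SOME F. flat_frame N (convex hull (S \<union> T)) F) = (p, B)" by fastforce
  have B: "orthonormal B" "card B = N" using frame [unfolded pB] by (auto simp: flat_frame_def)
  then have "finite B" using N(1) by (auto intro: card_ge_0_finite)
  then have "measure (subspace_lborel B) ((\<lambda>x. x - p) ` (convex hull (S \<union> T)))
      \<le> 2 ^ N * (4 ^ ((N + 1) * N) * \<delta> ^ m * R * \<epsilon> ^ q)"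
    using B content_A2 hull
    by (intro measure_subspace_lborel_le_content [where p = "s0 - p"]) auto
  then show ?thesis
    by (simp add: flat_volume_def pB mult.assoc)
qed

section \<open>Clusters\<close>

text \<open>The sum over \<open>E'\<close> dominates the distance to the span of \<open>E\<close>, which turns closeness of the
  \<open>E'\<close>-coordinates of two points into closeness modulo that span.\<close>
lemma orthonormal_complement_exists:
  fixes E :: "'a::euclidean_space set"
  assumes E: "orthonormal E" "finite E"
  obtains E' where "orthonormal E'" "finite E'" "card E' = DIM('a) - card E"
    "\<And>x. \<exists>u\<in>span E. norm (x - u) \<le> (\<Sum>b\<in>E'. \<bar>x \<bullet> b\<bar>)"
proof -
  define W where "W = {y. \<forall>x\<in>span E. orthogonal x y}"
  have "dim W + dim (span E) = DIM('a)"
    using dim_subspace_orthogonal_to_vectors [of "span E" UNIV] by (simp add: W_def)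
  moreover have "dim (span E) = card E"
    using E by (simp add: dim_eq_card_independent orthonormal_def pairwise_orthogonal_independent)
       (metis dim_eq_card_independent norm_zero pairwise_orthogonal_independent zero_neq_one)
  ultimately have dimW: "dim W = DIM('a) - card E" by simp
  have "subspace W"
    unfolding W_def by (auto simp: subspace_def orthogonal_def inner_add_right)
  then obtain E' where E': "pairwise orthogonal E'" "\<And>x. x \<in> E' \<Longrightarrow> norm x = 1"
    "independent E'" "card E' = dim W" "span E' = W"
    by (rule orthonormal_basis_subspace) blast
  have fin: "finite E'" using E'(3) by (rule independent_imp_finite)
  show thesis
  proof
    show "orthonormal E'" "finite E'" "card E' = DIM('a) - card E"
      using E' dimW fin by (auto simp: orthonormal_def)
    fix x :: 'a
    obtain y z where yz: "y \<in> span E" "\<And>w. w \<in> span E \<Longrightarrow> orthogonal z w" "x = y + z"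
      using orthogonal_subspace_decomp_exists [of E x] by blast
    then have "z \<in> span E'" by (auto simp: E'(5) W_def orthogonal_commute)
    then have "z = (\<Sum>b\<in>E'. (z \<bullet> b) *\<^sub>R b)"
      using E' fin by (intro orthonormal_basis_expand [symmetric]) auto
    also have "norm \<dots> \<le> (\<Sum>b\<in>E'. \<bar>z \<bullet> b\<bar>)"
      by (rule sum_norm_le) (simp add: E'(2))
    also have "\<dots> = (\<Sum>b\<in>E'. \<bar>x \<bullet> b\<bar>)"
    proof (rule sum.cong)
      fix b assume "b \<in> E'"
      then have "b \<in> W" using E'(5) span_base by blast
      then have "y \<bullet> b = 0" using yz(1) by (auto simp: W_def orthogonal_def)
      then show "\<bar>z \<bullet> b\<bar> = \<bar>x \<bullet> b\<bar>" by (simp add: yz(3) inner_add_left)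
    qed simp
    finally show "\<exists>u\<in>span E. norm (x - u) \<le> (\<Sum>b\<in>E'. \<bar>x \<bullet> b\<bar>)"
      using yz(1,3) by (intro bexI [of _ y]) auto
  qed
qed

text \<open>The quantity \<open>f x i\<close> is the \<open>i\<close>-th coordinate of the point \<open>x\<close>; since points are labels rather
  than coordinate vectors, distinct points may have the same coordinates, as happens after a
  projection. Subdividing each side of the box into \<open>g\<close> parts, where \<open>g\<close> is the integer part
  of the \<open>card I\<close>-th root of \<open>card P / q\<close>, leaves at most \<open>card P / q\<close> cells, so one of them holds
  \<open>q\<close> points.\<close>
lemma clustered_subset_exists:
  fixes f :: "'p \<Rightarrow> 'i \<Rightarrow> real"
  assumes P: "finite P" "q \<le> card P" and q: "0 < q" and I: "finite I" "I \<noteq> {}"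
    and R: "0 < R" "\<And>x i. x \<in> P \<Longrightarrow> i \<in> I \<Longrightarrow> \<bar>f x i\<bar> < R"
  shows "\<exists>T\<subseteq>P. card T = q \<and> (\<forall>x\<in>T. \<forall>y\<in>T. \<forall>i\<in>I.
           \<bar>f x i - f y i\<bar> \<le> 4 * R * (real (card P) / real q) powr (- (1 / real (card I))))"
proof -
  define e where "e = card I"
  define w where "w = (real (card P) / real q) powr (1 / real e)"
  define g where "g = nat \<lfloor>w\<rfloor>"
  have e: "0 < e" using I by (simp add: e_def card_gt_0_iff)
  have "1 \<le> w" unfolding w_def using P q by (intro ge_one_powr_ge_zero) auto
  then have "1 \<le> \<lfloor>w\<rfloor>" "real g = real_of_int \<lfloor>w\<rfloor>" by (simp_all add: g_def)
  then have g: "1 \<le> g" "real g \<le> w" "w \<le> 2 * real g" by linarith+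
  have "real g ^ e \<le> w ^ e" using g by (intro power_mono) auto
  also have "\<dots> = w powr real e" using \<open>1 \<le> w\<close> by (simp add: powr_realpow)
  also have "\<dots> = real (card P) / real q" unfolding w_def using P q e by (simp add: powr_powr)
  finally have g_pow: "real g ^ e * real q \<le> real (card P)" using q by (simp add: field_simps)
  define cell where "cell x = (\<lambda>i\<in>I. nat \<lfloor>(f x i + R) * g / (2 * R)\<rfloor>)" for x
  have cell: "cell \<in> P \<rightarrow> (\<Pi>\<^sub>E i\<in>I. {..<g})"
  proof
    fix x assume x: "x \<in> P"
    have "nat \<lfloor>(f x i + R) * g / (2 * R)\<rfloor> < g" if "i \<in> I" for i
    proof -
      have "f x i + R < 2 * R" using R(2) [OF x that] by linarith
      then have "(f x i + R) * g < 2 * R * g" using g by (intro mult_strict_right_mono) auto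
      then have "(f x i + R) * g / (2 * R) < g" using R(1) by (simp add: field_simps)
      then show ?thesis using g by linarith
    qed
    then show "cell x \<in> (\<Pi>\<^sub>E i\<in>I. {..<g})" by (auto simp: cell_def)
  qed
  have "finite (\<Pi>\<^sub>E i\<in>I. {..<g})" "(\<Pi>\<^sub>E i\<in>I. {..<g}) \<noteq> {}"
    using I g by (auto intro: finite_PiE simp: PiE_eq_empty_iff lessThan_empty_iff bot_nat_def)
  then obtain Y where Y: "card P \<le> card (cell -` {Y} \<inter> P) * card (\<Pi>\<^sub>E i\<in>I. {..<g})"
    using pigeonhole_card [OF cell P(1)] by blast
  have "card (\<Pi>\<^sub>E i\<in>I. {..<g}) = g ^ e" using I by (simp add: card_PiE e_def)
  with Y have "real (card P) \<le> real (card (cell -` {Y} \<inter> P)) * real g ^ e"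
    by (metis of_nat_le_iff of_nat_mult of_nat_power)
  with g_pow have "real g ^ e * real q \<le> real g ^ e * real (card (cell -` {Y} \<inter> P))"
    by (simp add: mult.commute)
  then have "q \<le> card (cell -` {Y} \<inter> P)" using g by simp
  then obtain T where T: "T \<subseteq> cell -` {Y} \<inter> P" "card T = q"
    by (meson obtain_subset_with_card_n)
  show ?thesis
  proof (intro exI [of _ T] conjI ballI)
    show "T \<subseteq> P" "card T = q" using T by auto
    fix x y i assume xyi: "x \<in> T" "y \<in> T" "i \<in> I"
    then have "cell x = Y" "cell y = Y" using T(1) by auto
    then have "cell x i = cell y i" by simp
    then have eq: "nat \<lfloor>(f x i + R) * g / (2 * R)\<rfloor> = nat \<lfloor>(f y i + R) * g / (2 * R)\<rfloor>"
      using xyi by (simp add: cell_def)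
    have pos: "0 \<le> (f z i + R) * g / (2 * R)" if "z \<in> T" for z
    proof -
      have "\<bar>f z i\<bar> < R" using R(2) xyi T(1) that by blast
      then show ?thesis using R(1) by (intro divide_nonneg_pos mult_nonneg_nonneg) auto
    qed
    have "\<bar>(f x i + R) * g / (2 * R) - (f y i + R) * g / (2 * R)\<bar> \<le> 1"
      using eq pos [OF xyi(1)] pos [OF xyi(2)] by linarith
    also have "(f x i + R) * g / (2 * R) - (f y i + R) * g / (2 * R) = (f x i - f y i) * (g / (2 * R))"
      using R(1) by (simp add: field_simps)
    finally have "\<bar>f x i - f y i\<bar> * (g / (2 * R)) \<le> 1"
      using R(1) by (simp add: abs_mult)
    then have "\<bar>f x i - f y i\<bar> \<le> 2 * R / g" using g R(1) by (simp add: field_simps)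
    also have "\<dots> \<le> 4 * R / w"
      using g R(1) \<open>1 \<le> w\<close> by (simp add: field_simps)
    finally show "\<bar>f x i - f y i\<bar> \<le> 4 * R * (real (card P) / real q) powr (- (1 / real (card I)))"
      by (simp add: w_def e_def powr_minus_divide)
  qed
qed

section \<open>Small simplices\<close>

text \<open>The set \<open>S\<close> consists of \<open>m + 1\<close> points that are close in all coordinates, and \<open>T\<close> of \<open>q + 1\<close>
  other points that are close modulo the directions of \<open>S\<close>. Both selections are made by pigeonhole,
  in \<open>d\<close> and in \<open>d - m\<close> coordinates, which accounts for the two denominators in the exponent.\<close>
lemma flat_volume_two_clusters_le_powr:
  fixes R :: real
  defines "d \<equiv> DIM('a::euclidean_space)"
  assumes R: "0 < R" and m: "m < d" and q: "m + 1 + q \<le> d"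
  shows "\<exists>C>0. \<forall>P :: 'a set. finite P \<and> P \<subseteq> ball 0 R \<and> m + q + 2 \<le> card P \<longrightarrow>
     (\<exists>K\<subseteq>P. card K = m + q + 2 \<and> flat_volume (m + 1 + q) (convex hull K)
        \<le> C * real (card P) powr (- (real m / real d + real q / real (d - m))))"
proof -
  define k where "k = m + q + 2"
  define N where "N = m + 1 + q"
  define \<alpha> where "\<alpha> = real m / real d + real q / real (d - m)"
  define C where "C = 2 ^ N * 4 ^ ((N + 1) * N) * (4 * real d * R) ^ (m + q) * (2 * R) * real k powr \<alpha>"
  have d: "0 < d" using m by simp
  have "C > 0" using R d by (simp add: C_def k_def)
  moreover have "\<exists>K\<subseteq>P. card K = k \<and> flat_volume N (convex hull K) \<le> C * real (card P) powr (- \<alpha>)"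
    if P: "finite P" "P \<subseteq> ball 0 R" and kP: "k \<le> card P" for P :: "'a set"
  proof -
    define n where "n = card P"
    \<comment> \<open>Both \<open>n / (m + 1)\<close> and \<open>(n - (m + 1)) / (q + 1)\<close>, the ratios of available to wanted points in
      the two selections, are at least \<open>x\<close>.\<close>
    define x where "x = real n / real k"
    have x: "1 \<le> x" using kP by (simp add: x_def n_def k_def)
    define \<delta> where "\<delta> = real d * (4 * R * x powr (- (1 / real d)))"
    define \<epsilon> where "\<epsilon> = real d * (4 * R * x powr (- (1 / real (d - m))))"
    have pos: "0 < \<delta>" "0 < \<epsilon>" using x R d by (auto simp: \<delta>_def \<epsilon>_def)
    have inner_R: "\<bar>y \<bullet> b\<bar> < R" if "y \<in> P" "norm b = 1" for y b :: 'a
      using Cauchy_Schwarz_ineq2 [of y b] that P(2) by (auto simp: subset_eq)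

    obtain S where S: "S \<subseteq> P" "card S = m + 1" "\<forall>y\<in>S. \<forall>z\<in>S. \<forall>b\<in>Basis.
        \<bar>y \<bullet> b - z \<bullet> b\<bar> \<le> 4 * R * (real n / real (m + 1)) powr (- (1 / real d))"
      using clustered_subset_exists [of P "m + 1" Basis R "\<lambda>y b. y \<bullet> b"] P kP R inner_R
      by (auto simp: n_def k_def d_def)
    have finS: "finite S" using S P finite_subset by blast
    have "S \<noteq> {}" using S by auto
    then obtain s0 where s0: "s0 \<in> S" by blast
    have "x \<le> real n / real (m + 1)"
      unfolding x_def by (intro divide_left_mono) (auto simp: k_def)
    then have shrink: "(real n / real (m + 1)) powr (- (1 / real d)) \<le> x powr (- (1 / real d))"
      using x by (intro powr_mono2') auto
    have S_diam: "norm (s - s0) \<le> \<delta>" if "s \<in> S" for s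
    proof -
      have "norm (s - s0) \<le> (\<Sum>b\<in>Basis. \<bar>(s - s0) \<bullet> b\<bar>)" by (rule norm_le_l1)
      also have "\<dots> \<le> (\<Sum>b\<in>(Basis :: 'a set). 4 * R * x powr (- (1 / real d)))"
      proof (rule sum_mono)
        fix b :: 'a assume "b \<in> Basis"
        then have "\<bar>s \<bullet> b - s0 \<bullet> b\<bar> \<le> 4 * R * (real n / real (m + 1)) powr (- (1 / real d))"
          using S(3) that s0 by blast
        also have "\<dots> \<le> 4 * R * x powr (- (1 / real d))" using shrink R by simp
        finally show "\<bar>(s - s0) \<bullet> b\<bar> \<le> 4 * R * x powr (- (1 / real d))"
          by (simp add: inner_diff_left)
      qed
      finally show ?thesis by (simp add: \<delta>_def d_def)
    qed

    have "aff_dim S \<le> int m" using aff_dim_le_card [OF finS] S(2) by simp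
    then obtain p E where "flat_frame m S (p, E)"
      using flat_frame_exists [of S m] m by (auto simp: d_def)
    then have E: "orthonormal E" "card E = m" "S \<subseteq> (\<lambda>v. p + v) ` span E"
      by (auto simp: flat_frame_def)
    have "independent E"
      using E(1) by (intro pairwise_orthogonal_independent) (auto simp: orthonormal_def)
    then have finE: "finite E" by (rule independent_imp_finite)
    have S_span: "s - s0 \<in> span E" if s: "s \<in> S" for s
    proof -
      obtain v v0 where "s = p + v" "v \<in> span E" "s0 = p + v0" "v0 \<in> span E"
        using E(3) s s0 by blast
      then show ?thesis by (simp add: span_diff)
    qed
    obtain E' where E': "orthonormal E'" "finite E'" "card E' = d - m"
      "\<And>y. \<exists>u\<in>span E. norm (y - u) \<le> (\<Sum>b\<in>E'. \<bar>y \<bullet> b\<bar>)"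
      using orthonormal_complement_exists [OF E(1) finE] unfolding E(2) d_def by metis

    have card_rest: "card (P - S) = n - (m + 1)"
      using S finS by (simp add: card_Diff_subset n_def)
    obtain T where T: "T \<subseteq> P - S" "card T = q + 1" "\<forall>y\<in>T. \<forall>z\<in>T. \<forall>b\<in>E'.
        \<bar>y \<bullet> b - z \<bullet> b\<bar> \<le> 4 * R * (real (n - (m + 1)) / real (q + 1)) powr (- (1 / real (d - m)))"
    proof -
      have "q + 1 \<le> card (P - S)" using kP by (simp add: card_rest n_def k_def)
      moreover have "E' \<noteq> {}" using E'(3) m by auto
      ultimately show thesis
        using clustered_subset_exists [of "P - S" "q + 1" E' R "\<lambda>y b. y \<bullet> b"] P E' R inner_R that
        by (auto simp: card_rest orthonormal_def)
    qed
    have finT: "finite T" using T P finite_subset by blast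
    have "T \<noteq> {}" using T by auto
    then obtain t0 where t0: "t0 \<in> T" by blast
    have "x \<le> real (n - (m + 1)) / real (q + 1)"
    proof -
      have "real k * real (m + 1) \<le> real n * real (m + 1)"
        using kP by (intro mult_right_mono) (auto simp: n_def)
      then show ?thesis
        using kP by (simp add: x_def n_def k_def of_nat_diff field_simps)
    qed
    from powr_mono2' [OF _ _ this, of "- (1 / real (d - m))"]
    have shrink': "(real (n - (m + 1)) / real (q + 1)) powr (- (1 / real (d - m)))
        \<le> x powr (- (1 / real (d - m)))"
      using x by simp
    have T_diam: "\<exists>u\<in>span E. norm (t - t0 - u) \<le> \<epsilon>" if "t \<in> T" for t
    proof -
      have "(\<Sum>b\<in>E'. \<bar>(t - t0) \<bullet> b\<bar>) \<le> (\<Sum>b\<in>E'. 4 * R * x powr (- (1 / real (d - m))))"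
      proof (rule sum_mono)
        fix b :: 'a assume "b \<in> E'"
        then have "\<bar>t \<bullet> b - t0 \<bullet> b\<bar>
            \<le> 4 * R * (real (n - (m + 1)) / real (q + 1)) powr (- (1 / real (d - m)))"
          using T(3) that t0 by blast
        also have "\<dots> \<le> 4 * R * x powr (- (1 / real (d - m)))" using shrink' R by simp
        finally show "\<bar>(t - t0) \<bullet> b\<bar> \<le> 4 * R * x powr (- (1 / real (d - m)))"
          by (simp add: inner_diff_left)
      qed
      also have "\<dots> = real (d - m) * (4 * R * x powr (- (1 / real (d - m))))"
        by (simp add: E'(3))
      also have "\<dots> \<le> \<epsilon>"
        unfolding \<epsilon>_def using R by (intro mult_right_mono) auto
      finally show ?thesis using E'(4) [of "t - t0"] by (meson order_trans)
    qed

    have gap: "norm (t0 - s0) \<le> 2 * R"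
    proof -
      have "norm t0 < R" "norm s0 < R" using P(2) S(1) T(1) s0 t0 by (auto simp: subset_eq)
      then show ?thesis using norm_triangle_ineq4 [of t0 s0] by linarith
    qed
    have "flat_volume N (convex hull (S \<union> T))
        \<le> 2 ^ N * 4 ^ ((N + 1) * N) * \<delta> ^ m * (2 * R) * \<epsilon> ^ q"
      using finS finT s0 t0 S T E finE S_diam S_span gap T_diam pos R q
      by (intro flat_volume_two_clusters [where E = E]) (auto simp: N_def d_def)
    also have "\<dots> = C * real n powr (- \<alpha>)"
    proof -
      have \<delta>_pow: "\<delta> ^ m = (4 * real d * R) ^ m * x powr (- (real m / real d))"
        and \<epsilon>_pow: "\<epsilon> ^ q = (4 * real d * R) ^ q * x powr (- (real q / real (d - m)))"
        using x by (simp_all add: \<delta>_def \<epsilon>_def power_mult_distrib powr_power)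
      have "x powr (- (real m / real d)) * x powr (- (real q / real (d - m))) = x powr (- \<alpha>)"
        by (simp add: \<alpha>_def flip: powr_add)
      also have "\<dots> = real k powr \<alpha> * real n powr (- \<alpha>)"
        by (simp add: x_def powr_divide powr_minus field_simps)
      finally have split: "x powr (- (real m / real d)) * x powr (- (real q / real (d - m)))
          = real k powr \<alpha> * real n powr (- \<alpha>)" .
      have "2 ^ N * 4 ^ ((N + 1) * N) * \<delta> ^ m * (2 * R) * \<epsilon> ^ q
          = 2 ^ N * 4 ^ ((N + 1) * N) * (4 * real d * R) ^ (m + q) * (2 * R)
            * (x powr (- (real m / real d)) * x powr (- (real q / real (d - m))))"
        unfolding \<delta>_pow \<epsilon>_pow power_add by (simp only: mult_ac)
      then show ?thesis unfolding split C_def by (simp only: mult_ac)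
    qed
    finally have "flat_volume N (convex hull (S \<union> T)) \<le> C * real n powr (- \<alpha>)" .
    moreover have "card (S \<union> T) = k"
      using S T finS finT by (subst card_Un_disjoint) (auto simp: k_def)
    ultimately show ?thesis
      using S(1) T(1) unfolding n_def by (intro exI [of _ "S \<union> T"]) auto
  qed
  ultimately show ?thesis
    unfolding k_def N_def \<alpha>_def by (intro exI [of _ C]) auto
qed

text \<open>Multiplying by \<open>d\<close> and cancelling turns the claim into
  \<open>1 + k\<^sup>2 / (8 * d) \<le> (k - m - 2) * m / (d - m)\<close>, where the 1 stands for the connecting edge. With
  \<open>m\<close> close to \<open>k / 2\<close>, the right-hand side is about \<open>k\<^sup>2 / (4 * d)\<close>, and what remains is essentially
  \<open>8 * d \<le> k\<^sup>2\<close>; the hypothesis \<open>9 * d \<le> k\<^sup>2\<close> leaves room for the lower-order terms.\<close>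
lemma exponent_gain:
  fixes k d m :: nat
  assumes d: "9 \<le> d" and k: "9 * d \<le> k\<^sup>2" "k \<le> d" and m: "m = (k - 1) div 2"
  shows "(real k - 1) / real d + (real k)\<^sup>2 / (8 * (real d)\<^sup>2)
    \<le> real m / real d + real (k - m - 2) / real (d - m)"
proof -
  define D K M where "D = real d" and "K = real k" and "M = real m"
  have "9 \<le> k"
  proof (rule ccontr)
    assume "\<not> 9 \<le> k"
    then have "k\<^sup>2 < 9\<^sup>2" by (intro power_strict_mono) auto
    then show False using d k by simp
  qed
  then have md: "m < d" "m + 2 \<le> k" using m k by auto
  have D: "9 \<le> D" "9 * D \<le> K\<^sup>2" "0 \<le> K" "0 \<le> M" "M < D"
    using d k(1) md by (auto simp: D_def K_def M_def simp flip: of_nat_power of_nat_mult)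
  have gain: "K\<^sup>2 \<le> 9 * (K\<^sup>2 - 8 * D)" "0 \<le> K\<^sup>2 - 8 * D" using D by auto
  have "9 * (K\<^sup>2 - 8 * D) \<le> D * (K\<^sup>2 - 8 * D)" using gain D by (intro mult_right_mono) auto
  moreover have "0 \<le> K * (K\<^sup>2 - 8 * D)" using gain D by simp
  ultimately have main: "2 * K\<^sup>2 \<le> (2 * D + K) * (K\<^sup>2 - 8 * D)"
    using gain by (simp add: distrib_right)
  have "k = 2 * m + 1 \<or> k = 2 * m + 2" using m \<open>9 \<le> k\<close> by presburger
  then have "(8 * D + K\<^sup>2) * (D - M) \<le> 8 * D * ((K - M - 2) * M)"
  proof
    assume "k = 2 * m + 1"
    then have M: "M = (K - 1) / 2" by (simp add: K_def M_def)
    have "2 * (8 * D * ((K - M - 2) * M) - (8 * D + K\<^sup>2) * (D - M))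
        = (2 * D + K) * (K\<^sup>2 - 8 * D) + 4 * D - K\<^sup>2"
      unfolding M by (simp add: field_simps power2_eq_square)
    moreover have "0 \<le> (2 * D + K) * (K\<^sup>2 - 8 * D) + 4 * D - K\<^sup>2"
      using main D(1) zero_le_power2 [of K] by linarith
    ultimately show ?thesis by simp
  next
    assume "k = 2 * m + 2"
    then have M: "M = (K - 2) / 2" by (simp add: K_def M_def)
    have "2 * (8 * D * ((K - M - 2) * M) - (8 * D + K\<^sup>2) * (D - M))
        = (2 * D + K) * (K\<^sup>2 - 8 * D) - 2 * K\<^sup>2"
      unfolding M by (simp add: field_simps power2_eq_square)
    moreover have "0 \<le> (2 * D + K) * (K\<^sup>2 - 8 * D) - 2 * K\<^sup>2" using main by simp
    ultimately show ?thesis by simp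
  qed
  then have "(8 * D + K\<^sup>2) * (D - M) / (8 * D\<^sup>2 * (D - M)) \<le> 8 * D * ((K - M - 2) * M) / (8 * D\<^sup>2 * (D - M))"
    using D by (intro divide_right_mono) auto
  moreover have "(8 * D + K\<^sup>2) * (D - M) / (8 * D\<^sup>2 * (D - M)) = 1 / D + K\<^sup>2 / (8 * D\<^sup>2)"
    using D by (simp add: field_simps power2_eq_square)
  moreover have "8 * D * ((K - M - 2) * M) / (8 * D\<^sup>2 * (D - M)) = (K - M - 2) / (D - M) - (K - M - 2) / D"
    using D by (simp add: field_simps power2_eq_square)
  ultimately have "(K - 1) / D + K\<^sup>2 / (8 * D\<^sup>2) \<le> M / D + (K - M - 2) / (D - M)"
    by (simp add: diff_divide_distrib)
  moreover have "real (k - m - 2) = K - M - 2" "real (d - m) = D - M"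
    using md by (simp_all add: D_def K_def M_def of_nat_diff)
  ultimately show ?thesis by (simp only: D_def K_def M_def)
qed

theorem corollary1p5:
  fixes k :: nat
  assumes "CARD('d::finite) \<ge> 9"
    and "3 * sqrt (real CARD('d)) \<le> real k"
    and "k \<le> CARD('d)"
  shows "\<exists>C>0. \<forall>n\<ge>k. heilbronn_simplex TYPE('d) k n
      \<le> C * real n powr (- ((real k - 1) / real CARD('d)) - (real k)\<^sup>2 / (8 * (real CARD('d))\<^sup>2))"
proof -
  define d where "d = CARD('d)"
  define m where "m = (k - 1) div 2"
  define q where "q = k - m - 2"
  have "(3 * sqrt (real d))\<^sup>2 \<le> (real k)\<^sup>2"
    using assms(2) by (intro power_mono) (auto simp: d_def)
  then have "real (9 * d) \<le> real (k\<^sup>2)" by (simp add: power_mult_distrib)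
  then have k2: "9 * d \<le> k\<^sup>2" by linarith
  have "3 * 1 \<le> 3 * sqrt (real d)" using assms(1) by (intro mult_left_mono) (auto simp: d_def)
  then have "3 \<le> real k" using assms(2) unfolding d_def by linarith
  then have "3 \<le> k" by simp
  then have mq: "m + q + 2 = k" "m + 1 + q = k - 1" "m < d" "m + 1 + q \<le> d" "0 < k"
    using assms(3) by (auto simp: m_def q_def d_def)
  have dim: "DIM(real ^ 'd) = d" by (simp add: d_def)
  obtain C where C: "C > 0" "\<And>P :: (real ^ 'd) set. finite P \<Longrightarrow> P \<subseteq> ball 0 (real d + 1) \<Longrightarrow> k \<le> card P \<Longrightarrow>
     \<exists>K\<subseteq>P. card K = k \<and> flat_volume (k - 1) (convex hull K)
        \<le> C * real (card P) powr (- (real m / real d + real q / real (d - m)))"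
    using flat_volume_two_clusters_le_powr [where 'a = "real ^ 'd" and R = "real d + 1" and m = m and q = q] mq
    unfolding dim mq by auto
  have unit_cube: "cbox 0 1 \<subseteq> (ball 0 (real d + 1) :: (real ^ 'd) set)"
  proof
    fix y :: "real ^ 'd" assume "y \<in> cbox 0 1"
    then have "\<bar>y $ i\<bar> \<le> 1" for i by (auto simp: mem_box_cart abs_le_iff intro: order_trans [of _ 0])
    then have "(\<Sum>i\<in>UNIV. \<bar>y $ i\<bar>) \<le> (\<Sum>i\<in>(UNIV :: 'd set). 1)" by (intro sum_mono)
    then show "y \<in> ball 0 (real d + 1)" using norm_le_l1_cart [of y] by (simp add: d_def)
  qed
  define \<beta> where "\<beta> = - ((real k - 1) / real d) - (real k)\<^sup>2 / (8 * (real d)\<^sup>2)"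
  have gain: "- (real m / real d + real q / real (d - m)) \<le> \<beta>"
    using exponent_gain [of d k m] k2 assms by (simp add: \<beta>_def d_def m_def q_def)
  have "heilbronn_simplex TYPE('d) k n \<le> C * real n powr \<beta>" if "k \<le> n" for n
    unfolding heilbronn_simplex_def
  proof (rule cInf_lower, safe)
    show "bdd_below {\<Delta>. \<Delta> > 0 \<and> (\<forall>P :: (real ^ 'd) set. P \<subseteq> cbox 0 1 \<and> finite P \<and> card P = n \<longrightarrow>
          (\<exists>K \<subseteq> P. card K = k \<and> flat_volume (k - 1) (convex hull K) \<le> \<Delta>))}"
      by (intro bdd_belowI [of _ 0]) auto
    show "0 < C * real n powr \<beta>" using C(1) that mq by simp
    fix P :: "(real ^ 'd) set" assume P: "P \<subseteq> cbox 0 1" "finite P" "n = card P"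
    then have "P \<subseteq> ball 0 (real d + 1)" "k \<le> card P" using unit_cube that by blast+
    with P obtain K where K: "K \<subseteq> P" "card K = k" "flat_volume (k - 1) (convex hull K)
        \<le> C * real n powr (- (real m / real d + real q / real (d - m)))"
      using C(2) by blast
    have "C * real n powr (- (real m / real d + real q / real (d - m))) \<le> C * real n powr \<beta>"
      using C(1) gain that mq by (intro mult_left_mono powr_mono) auto
    with K show "\<exists>K\<subseteq>P. card K = k \<and> flat_volume (k - 1) (convex hull K) \<le> C * real (card P) powr \<beta>"
      using P(3) by (intro exI [of _ K]) auto
  qed
  then show ?thesis using C(1) unfolding \<beta>_def d_def by blast
qed

end
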